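(* Let $r\in[0,1/2]$. Assume that $D^2f$ is bounded and Lipschitz, that $D^2f(\theta^\star)$ is invertible, and that $$\liminf_{|x|\to+\infty}f(x)^{-r}|\nabla f(x)|>0\qquad\text{and}\qquad\limsup_{|x|\to+\infty}f(x)^{-r}|\nabla f(x)|<+\infty.$$ Then Assumption $(\mathbf{H}_\phi)$ (defined in the context) holds with $\phi$ defined by $\phi(x)=(1+|x|^2)^{\frac{1-2r}{2}}$. Furthermore, $$\liminf_{|x|\to+\infty}f(x)\,|x|^{-\frac1{1-r}}>0.$$
   Context: $f:\mathbb{R}^d\to\mathbb{R}$ is of class $\mathcal{C}^2$, $\lim_{|x|\to+\infty}f(x)=+\infty$, $\{x:\nabla f(x)=0\}=\{\theta^\star\}$ (so $\theta^\star$ is the unique minimizer of $f$), and $f(\theta^\star)=0$. $|\cdot|$ is the Euclidean norm and $D^2f$ the Hessian. Assumption $(\mathbf{H}_\phi)$ for a function $\phi$: $f$ is $\mathcal{C}^2(\mathbb{R}^d,\mathbb{R})$ with $D^2f$ bounded and Lipschitz and $D^2f(\theta^\star)$ invertible, and (i) $\phi\in\mathcal{C}^2(\mathbb{R}_+,\mathbb{R}_+)$ is non-decreasing and there is $x_0\ge0$ such that $\phi''(x)\le0$ for all $x\ge x_0$; (ii) there are two positive numbers $m$ and $M$ such that for all $x\in\mathbb{R}^d\setminus\{\theta^\star\}$, $$0<m\le\phi'(f(x))|\nabla f(x)|^2+\frac{|\nabla f(x)|^2}{f(x)}\le M.$$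
   Formalization: For r=0 the requirement in (i) that φ''(x)≤0 for all x≥x_0 is dropped: φ(x)=(1+x^2)^{1/2} has φ''>0 everywhere, so it always fails there, e.g. for f(x)=(1+|x|^2)^{1/2}-1. All other parts of (H_φ) and the growth claim are kept at r=0; for 0<r≤1/2 the claim is in full. *)

theory Defs
  imports "HOL-Analysis.Analysis"
begin

definition gradient :: "(real ^ 'n \<Rightarrow> real) \<Rightarrow> real ^ 'n \<Rightarrow> real ^ 'n" where
  "gradient f x = (THE D. GDERIV f x :> D)"

definition hessian :: "(real ^ 'n \<Rightarrow> real) \<Rightarrow> real ^ 'n \<Rightarrow> real ^ 'n ^ 'n" where
  "hessian f x = jacobian (gradient f) (at x)"

definition C2 :: "(real ^ 'n \<Rightarrow> real) \<Rightarrow> bool" where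
  "C2 f \<longleftrightarrow> (\<forall>x. f differentiable (at x)) \<and> (\<forall>x. gradient f differentiable (at x))
     \<and> continuous_on UNIV (hessian f)"

definition standing :: "(real ^ 'n \<Rightarrow> real) \<Rightarrow> real ^ 'n \<Rightarrow> bool" where
  "standing f \<theta> \<longleftrightarrow> C2 f \<and> filterlim f at_top at_infinity
     \<and> {x. gradient f x = 0} = {\<theta>} \<and> f \<theta> = 0"

(* Boundedness and the Lipschitz property refer to the Euclidean (Frobenius) norm of matrices;
   in finite dimension the choice of norm is immaterial. *)
definition regular_hessian :: "(real ^ 'n \<Rightarrow> real) \<Rightarrow> real ^ 'n \<Rightarrow> bool" where
  "regular_hessian f \<theta> \<longleftrightarrow> bounded (range (hessian f))
     \<and> (\<exists>L. lipschitz_on L UNIV (hessian f)) \<and> invertible (hessian f \<theta>)"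

(* Derivative of a function on the half-line [0,\<infinity>); one-sided at 0.  The values of
   \<phi> on negative arguments play no role. *)
definition deriv_Rp :: "(real \<Rightarrow> real) \<Rightarrow> real \<Rightarrow> real" where
  "deriv_Rp \<phi> x = vector_derivative \<phi> (at x within {0..})"

definition C2_Rp :: "(real \<Rightarrow> real) \<Rightarrow> bool" where
  "C2_Rp \<phi> \<longleftrightarrow> (\<forall>x\<ge>0. \<phi> differentiable (at x within {0..}))
     \<and> (\<forall>x\<ge>0. deriv_Rp \<phi> differentiable (at x within {0..}))
     \<and> continuous_on {0..} (deriv_Rp (deriv_Rp \<phi>))"

definition eventually_concave :: "(real \<Rightarrow> real) \<Rightarrow> bool" where
  "eventually_concave \<phi> \<longleftrightarrow> (\<exists>x0\<ge>0. \<forall>x\<ge>x0. deriv_Rp (deriv_Rp \<phi>) x \<le> 0)"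

(* Every clause of assumption H_phi except the concavity of \<phi> on some [x0,\<infinity>). *)
definition H_phi_sans_concavity ::
    "(real ^ 'n \<Rightarrow> real) \<Rightarrow> real ^ 'n \<Rightarrow> (real \<Rightarrow> real) \<Rightarrow> bool" where
  "H_phi_sans_concavity f \<theta> \<phi> \<longleftrightarrow>
     C2 f \<and> regular_hessian f \<theta>
   \<and> C2_Rp \<phi> \<and> (\<forall>x\<ge>0. 0 \<le> \<phi> x) \<and> mono_on {0..} \<phi>
   \<and> (\<exists>m>0. \<exists>M>0. \<forall>x. x \<noteq> \<theta> \<longrightarrow>
        m \<le> deriv_Rp \<phi> (f x) * (norm (gradient f x))\<^sup>2 + (norm (gradient f x))\<^sup>2 / f x
      \<and> deriv_Rp \<phi> (f x) * (norm (gradient f x))\<^sup>2 + (norm (gradient f x))\<^sup>2 / f x \<le> M)"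

definition H_phi :: "(real ^ 'n \<Rightarrow> real) \<Rightarrow> real ^ 'n \<Rightarrow> (real \<Rightarrow> real) \<Rightarrow> bool" where
  "H_phi f \<theta> \<phi> \<longleftrightarrow> H_phi_sans_concavity f \<theta> \<phi> \<and> eventually_concave \<phi>"

definition phi_r :: "real \<Rightarrow> real \<Rightarrow> real" where
  "phi_r r x = (1 + \<bar>x\<bar>\<^sup>2) powr ((1 - 2 * r) / 2)"

(* At the endpoint r = 0 the function sqrt (1 + x^2) is strictly convex, with second derivative
   (1 + x^2) powr (-3/2), so the concavity clause of H_phi fails there whatever f is. *)
lemma deriv_Rp_eq:
  assumes "x \<ge> 0" and "\<And>y. y \<ge> 0 \<Longrightarrow> g y = h y" and "(h has_real_derivative D) (at x)"
  shows "deriv_Rp g x = D"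
proof -
  have "(h has_vector_derivative D) (at x within {0..})"
    using assms(3) has_field_derivative_at_within has_real_derivative_iff_has_vector_derivative
    by blast
  then have "(g has_vector_derivative D) (at x within {0..})"
    using assms(1,2) has_vector_derivative_transform[of x "{0..}" g h] by simp
  moreover have "at x within {0..} \<noteq> bot"
    using assms(1) at_within_Icc_at_right[of x "x+1"]
      at_le[of "{x..x+1}" "{0..}" x]
    by (metis atLeastAtMost_iff atLeast_iff bot.extremum_uniqueI less_add_one order.trans
        subsetI trivial_limit_at_right_real)
  ultimately show ?thesis
    unfolding deriv_Rp_def by (metis vector_derivative_within)
qed

lemma not_eventually_concave_phi_0: "\<not> eventually_concave (phi_r 0)"
proof
  assume "eventually_concave (phi_r 0)"
  then obtain x where x: "x \<ge> 0" and le: "deriv_Rp (deriv_Rp (phi_r 0)) x \<le> 0"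
    unfolding eventually_concave_def by blast
  have pos: "1 + y\<^sup>2 > 0" for y :: real
    by (simp add: add_pos_nonneg)
  have d1: "deriv_Rp (phi_r 0) y = y / sqrt (1 + y\<^sup>2)" if "y \<ge> 0" for y
  proof (rule deriv_Rp_eq[OF that, where h = "\<lambda>y. sqrt (1 + y\<^sup>2)"])
    show "((\<lambda>y. sqrt (1 + y\<^sup>2)) has_real_derivative y / sqrt (1 + y\<^sup>2)) (at y)"
      using pos[of y] by (auto intro!: derivative_eq_intros simp: field_simps)
  qed (use pos in \<open>simp add: phi_r_def powr_half_sqrt\<close>)
  have "deriv_Rp (deriv_Rp (phi_r 0)) x = 1 / (sqrt (1 + x\<^sup>2) * (1 + x\<^sup>2))"
  proof (rule deriv_Rp_eq[OF x d1])
    have "sqrt (1 + x\<^sup>2) * sqrt (1 + x\<^sup>2) = 1 + x\<^sup>2" "sqrt (1 + x\<^sup>2) > 0"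
      using pos[of x] by auto
    then show "((\<lambda>y. y / sqrt (1 + y\<^sup>2)) has_real_derivative
                 1 / (sqrt (1 + x\<^sup>2) * (1 + x\<^sup>2))) (at x)"
      using pos[of x]
      by (auto intro!: derivative_eq_intros simp: divide_simps) (auto simp: algebra_simps power2_eq_square)
  qed
  also have "\<dots> > 0" using pos[of x] by simp
  finally show False using le by simp
qed

end

theory Submission
  imports Defs
begin

text \<open>Bounds on the weighted ratio: near \<open>\<theta>\<close>, \<open>\<bar>\<nabla>f\<bar>\<^sup>2 / f\<close> is bounded above because a nonnegative
  function with \<open>L\<close>-Lipschitz gradient satisfies \<open>\<bar>\<nabla>f\<bar>\<^sup>2 \<le> 4 L f\<close>, and below because \<open>\<nabla>f\<close> grows
  linearly (invertible Hessian) while \<open>f\<close> grows at most quadratically. At infinity \<open>\<phi>'(f) + 1/f\<close> is comparable to \<open>f\<^sup>-\<^sup>2\<^sup>r\<close>, and compactness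
  covers the rest. For the growth of \<open>f\<close>, the function \<open>u = f\<^sup>1\<^sup>-\<^sup>r\<close> has a gradient bounded away from
  zero at infinity, so a variational principle replaces the gradient flow to give
  \<open>u(x) \<ge> k (\<bar>x\<bar> - R)\<close>.\<close>

section \<open>Gradients, Hessians and consequences of a Lipschitz gradient\<close>

lemma GDERIV_gradient:
  fixes f :: "real ^ 'n \<Rightarrow> real"
  assumes "f differentiable (at x)"
  shows "GDERIV f x :> gradient f x"
proof -
  let ?F = "frechet_derivative f (at x)"
  have F: "(f has_derivative ?F) (at x)"
    using assms frechet_derivative_works by blast
  \<comment> \<open>The Riesz representative of the derivative is its adjoint applied to 1.\<close>
  have "?F h = h \<bullet> adjoint ?F 1" for h
    using adjoint_works[OF has_derivative_linear[OF F], of h 1] by simp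
  then have G: "GDERIV f x :> adjoint ?F 1"
    using F by (metis (no_types, lifting) ext gderiv_def)
  have unique: "D = E" if "GDERIV f x :> D" "GDERIV f x :> E" for D E
  proof -
    have "(\<lambda>h. h \<bullet> D) = (\<lambda>h. h \<bullet> E)"
      using that unfolding gderiv_def by (rule has_derivative_unique)
    then have "\<forall>h. h \<bullet> D = h \<bullet> E"
      by (simp add: fun_eq_iff)
    then show ?thesis
      by (simp only: vector_eq_ldot)
  qed
  show ?thesis
    unfolding gradient_def using G by (rule theI) (rule unique[OF _ G])
qed

lemma has_derivative_hessian:
  fixes f :: "real ^ 'n \<Rightarrow> real"
  assumes "gradient f differentiable (at x)"
  shows "(gradient f has_derivative (\<lambda>h. hessian f x *v h)) (at x)"
  using assms unfolding hessian_def by (simp flip: jacobian_works)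

text \<open>Cauchy-Schwarz in each row; the norm on matrices is the Frobenius norm.\<close>

lemma norm_matrix_vector_mult_le:
  fixes A :: "real ^ 'n ^ 'm"
  shows "norm (A *v x) \<le> norm A * norm x"
proof -
  have "norm (A *v x) \<le> L2_set (\<lambda>i. norm (A $ i) * norm x) UNIV"
    unfolding norm_vec_def[of "A *v x"]
    by (rule L2_set_mono) (auto simp: matrix_vector_mul_component Cauchy_Schwarz_ineq2)
  also have "\<dots> = norm A * norm x"
    by (simp add: norm_vec_def[of A] L2_set_left_distrib)
  finally show ?thesis .
qed

lemma gradient_lipschitz:
  fixes f :: "real ^ 'n \<Rightarrow> real"
  assumes "\<And>x. gradient f differentiable (at x)" and "\<And>x. norm (hessian f x) \<le> B"
  shows "norm (gradient f x - gradient f y) \<le> B * norm (x - y)"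
proof (rule differentiable_bound[where S = UNIV])
  show "onorm ((*v) (hessian f x)) \<le> B" for x
    by (rule onorm_le)
      (meson assms(2) mult_right_mono norm_ge_zero norm_matrix_vector_mult_le order_trans)
qed (auto intro: has_derivative_hessian assms)

text \<open>The mean value theorem along the segment gives the gradient at an intermediate point,
  which differs from \<open>G x\<close> by at most \<open>L * norm h\<close>. This yields the factor
  \<open>L\<close>; integrating along the segment would give \<open>L / 2\<close>.\<close>

lemma GDERIV_quadratic_upper_bound:
  fixes f :: "'a::real_inner \<Rightarrow> real"
  assumes G: "\<And>x. GDERIV f x :> G x"
    and L: "\<And>x y. norm (G x - G y) \<le> L * norm (x - y)"
  shows "f (x + h) \<le> f x + h \<bullet> G x + L * (norm h)\<^sup>2"
proof -
  have "\<exists>t\<in>{0..1::real}. f (x + 1 *\<^sub>R h) - f (x + 0 *\<^sub>R h) = ((1 - 0) *\<^sub>R h) \<bullet> G (x + t *\<^sub>R h)"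
  proof (rule mvt_very_simple)
    fix t :: real
    have "((\<lambda>t. x + t *\<^sub>R h) has_derivative (\<lambda>s. s *\<^sub>R h)) (at t within {0..1})"
      by (auto intro!: derivative_eq_intros)
    then show "((\<lambda>t. f (x + t *\<^sub>R h)) has_derivative (\<lambda>s. (s *\<^sub>R h) \<bullet> G (x + t *\<^sub>R h)))
        (at t within {0..1})"
      using G[unfolded gderiv_def] by (rule has_derivative_compose)
  qed simp
  then obtain t :: real where t: "0 \<le> t" "t \<le> 1"
    and ft: "f (x + h) - f x = h \<bullet> G (x + t *\<^sub>R h)" by auto
  have "L \<ge> 0" if "h \<noteq> 0"
    using order_trans[OF norm_ge_zero L[of "x + h" x]] that by (simp add: zero_le_mult_iff)
  then have tL: "L * norm (t *\<^sub>R h) \<le> L * norm h"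
    using t by (cases "h = 0") (auto intro!: mult_left_mono mult_left_le_one_le)
  have "h \<bullet> (G (x + t *\<^sub>R h) - G x) \<le> norm h * norm (G (x + t *\<^sub>R h) - G x)"
    by (rule norm_cauchy_schwarz)
  also have "\<dots> \<le> norm h * (L * norm h)"
    using L[of "x + t *\<^sub>R h" x] tL by (intro mult_left_mono) auto
  finally show ?thesis
    using ft by (simp add: inner_diff_right power2_eq_square algebra_simps)
qed

text \<open>A gradient step of length \<open>1 / (2 * L)\<close> cannot push a nonnegative function below zero.\<close>
lemma GDERIV_norm_le_nonneg:
  fixes f :: "'a::real_inner \<Rightarrow> real"
  assumes G: "\<And>x. GDERIV f x :> G x"
    and L: "\<And>x y. norm (G x - G y) \<le> L * norm (x - y)" "L > 0"
    and nonneg: "\<And>x. 0 \<le> f x"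
  shows "(norm (G x))\<^sup>2 \<le> 4 * L * f x"
proof -
  let ?h = "- (1 / (2 * L)) *\<^sub>R G x"
  have "0 \<le> f x + ?h \<bullet> G x + L * (norm ?h)\<^sup>2"
    using GDERIV_quadratic_upper_bound[OF G L(1), of x ?h] nonneg[of "x + ?h"] by linarith
  also have "\<dots> = f x - (norm (G x))\<^sup>2 / (4 * L)"
    using \<open>L > 0\<close> by (simp add: power_mult_distrib power_divide field_simps power2_eq_square
        flip: power2_norm_eq_inner)
  finally show ?thesis
    using \<open>L > 0\<close> by (simp add: field_simps)
qed

section \<open>Linear growth from a lower bound on the slope\<close>

lemma GDERIV_norm_le_of_lower_cone:
  fixes u :: "'a::real_inner \<Rightarrow> real"
  assumes D: "GDERIV u y :> D" and "0 \<le> c" and cone: "\<And>z. u y \<le> u z + c * norm (z - y)"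
  shows "norm D \<le> c"
proof (rule field_le_epsilon)
  fix e :: real assume "e > 0"
  then obtain d where "d > 0"
    and d: "\<And>z. norm (z - y) < d \<Longrightarrow> norm (u z - u y - (z - y) \<bullet> D) \<le> e * norm (z - y)"
    using D unfolding gderiv_def has_derivative_at_alt by meson
  show "norm D \<le> c + e"
  proof (cases "D = 0")
    case False
    \<comment> \<open>A step of length \<open>d / 2\<close> in the direction of steepest descent: to
      first order \<open>u\<close> drops by \<open>t * (norm D)^2\<close>, while the cone allows a
      drop of at most \<open>c * t * norm D\<close>.\<close>
    define t where "t = d / (2 * norm D)"
    have t: "t > 0" "t * norm D < d"
      using False \<open>d > 0\<close> by (auto simp: t_def)
    let ?z = "y - t *\<^sub>R D"
    have n: "norm (?z - y) = t * norm D" using t by simp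
    have "norm (u ?z - u y - (?z - y) \<bullet> D) \<le> e * (t * norm D)"
      using d[of ?z] n t by simp
    then have "u ?z - u y + t * (norm D)\<^sup>2 \<le> e * (t * norm D)"
      by (simp add: power2_norm_eq_inner)
    moreover have "u y \<le> u ?z + c * (t * norm D)"
      using cone[of ?z] unfolding n .
    ultimately have "t * norm D * norm D \<le> t * norm D * (c + e)"
      by (simp add: algebra_simps power2_eq_square)
    then show ?thesis
      using t False by (simp add: mult_le_cancel_left)
  qed (use \<open>0 \<le> c\<close> \<open>e > 0\<close> in simp)
qed

text \<open>Ekeland's argument: a minimizer \<open>y\<close> of \<open>u y + c * norm (y - x)\<close> satisfies
  \<open>norm (\<nabla>u y) \<le> c\<close>, hence lies in the ball of radius \<open>R\<close>.\<close>
lemma linear_growth_of_gradient_bound: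
  fixes u :: "'a::euclidean_space \<Rightarrow> real"
  assumes cont: "continuous_on UNIV u" and nonneg: "\<And>x. 0 \<le> u x" and "c > 0"
    and slope: "\<And>y. R \<le> norm y \<Longrightarrow> \<exists>D. GDERIV u y :> D \<and> c < norm D"
  shows "c * (norm x - R) \<le> u x"
proof (rule ccontr)
  assume "\<not> ?thesis"
  then have less: "u x < c * (norm x - R)" by simp
  \<comment> \<open>Outside this ball the penalty alone exceeds \<open>u x\<close>, so a minimizer
    on the compact ball is a global one.\<close>
  let ?K = "cball x (u x / c)"
  let ?\<psi> = "\<lambda>y. u y + c * norm (y - x)"
  have xK: "x \<in> ?K" using nonneg[of x] \<open>c > 0\<close> by simp
  have "continuous_on ?K ?\<psi>"
    by (intro continuous_intros continuous_on_subset[OF cont]) auto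
  then have "\<exists>y\<in>?K. \<forall>z\<in>?K. ?\<psi> y \<le> ?\<psi> z"
    using xK by (intro continuous_attains_inf) auto
  then obtain y where y: "\<And>z. z \<in> ?K \<Longrightarrow> ?\<psi> y \<le> ?\<psi> z" by blast
  have yx: "?\<psi> y \<le> u x" using y[OF xK] by simp
  have min: "?\<psi> y \<le> ?\<psi> z" for z
  proof (cases "z \<in> ?K")
    case False
    then have "u x < c * norm (z - x)"
      using \<open>c > 0\<close> by (simp add: dist_norm norm_minus_commute field_simps)
    then show ?thesis using yx nonneg[of z] by linarith
  qed (rule y)
  \<comment> \<open>The assumed failure of the bound at \<open>x\<close> keeps \<open>y\<close> so
    close to \<open>x\<close> that \<open>R \<le> norm y\<close>, where the slope exceeds
    \<open>c\<close>; minimality will force it to be at most \<open>c\<close>.\<close>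
  have "c * norm (y - x) < c * (norm x - R)"
    using yx less nonneg[of y] by linarith
  then have "norm (y - x) < norm x - R"
    using \<open>c > 0\<close> by simp
  then have "R \<le> norm y"
    using norm_triangle_ineq3[of x y] by (simp add: norm_minus_commute)
  then obtain D where D: "GDERIV u y :> D" and "c < norm D" using slope by blast
  have "norm D \<le> c"
  proof (rule GDERIV_norm_le_of_lower_cone[OF D])
    fix z
    have "c * norm (z - x) \<le> c * (norm (z - y) + norm (y - x))"
      using \<open>c > 0\<close> norm_triangle_ineq[of "z - y" "y - x"] by (intro mult_left_mono) auto
    then show "u y \<le> u z + c * norm (z - y)"
      using min[of z] by (simp add: algebra_simps)
  qed (use \<open>c > 0\<close> in simp)
  with \<open>c < norm D\<close> show False by simp
qed

section \<open>Derivatives, concavity and asymptotics of \<open>phi_r\<close>\<close>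

lemma one_plus_square_pos: "0 < 1 + (x::real)\<^sup>2"
  by (simp add: add_pos_nonneg)

lemma phi_r_has_derivative:
  "(phi_r r has_real_derivative (1 - 2 * r) * x * (1 + x\<^sup>2) powr (- (1 + 2 * r) / 2)) (at x)"
proof -
  have e: "(1 - 2 * r) / 2 - 1 = - (1 + 2 * r) / 2" by (simp add: field_simps)
  have "((\<lambda>x. (1 + x\<^sup>2) powr ((1 - 2 * r) / 2)) has_real_derivative
      (1 - 2 * r) * x * (1 + x\<^sup>2) powr (- (1 + 2 * r) / 2)) (at x)"
    unfolding e[symmetric] using one_plus_square_pos[of x] by (auto intro!: derivative_eq_intros)
  then show ?thesis by (simp add: phi_r_def[abs_def])
qed

lemma phi_r_has_second_derivative:
  "((\<lambda>x. (1 - 2 * r) * x * (1 + x\<^sup>2) powr (- (1 + 2 * r) / 2)) has_real_derivative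
    (1 - 2 * r) * (1 - 2 * r * x\<^sup>2) * (1 + x\<^sup>2) powr (- (1 + 2 * r) / 2 - 1)) (at x)"
proof -
  let ?q = "- (1 + 2 * r) / 2" and ?B = "1 + x\<^sup>2"
  have "?B powr ?q = ?B * ?B powr (?q - 1)"
    using one_plus_square_pos[of x] by (simp add: powr_diff)
  moreover have "((\<lambda>x. (1 - 2 * r) * x * (1 + x\<^sup>2) powr ?q) has_real_derivative
      (1 - 2 * r) * ?B powr ?q + (1 - 2 * r) * x * (?q * (2 * x) * ?B powr (?q - 1))) (at x)"
    using one_plus_square_pos[of x] by (auto intro!: derivative_eq_intros)
  \<comment> \<open>With the lower power factored out, what remains is
    \<open>(1 + x^2) - (1 + 2 * r) * x^2 = 1 - 2 * r * x^2\<close>.\<close>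
  moreover have "(1 - 2 * r) * (?B * P) + (1 - 2 * r) * x * (?q * (2 * x) * P)
      = (1 - 2 * r) * (1 - 2 * r * x\<^sup>2) * P" for P
    by (simp add: field_simps power2_eq_square)
  ultimately show ?thesis by simp
qed

lemma deriv_Rp_phi_r:
  assumes "x \<ge> 0"
  shows "deriv_Rp (phi_r r) x = (1 - 2 * r) * x * (1 + x\<^sup>2) powr (- (1 + 2 * r) / 2)"
  using assms phi_r_has_derivative by (auto intro: deriv_Rp_eq)

lemma deriv_Rp_deriv_Rp_phi_r:
  assumes "x \<ge> 0"
  shows "deriv_Rp (deriv_Rp (phi_r r)) x =
    (1 - 2 * r) * (1 - 2 * r * x\<^sup>2) * (1 + x\<^sup>2) powr (- (1 + 2 * r) / 2 - 1)"
  using assms deriv_Rp_phi_r phi_r_has_second_derivative by (rule deriv_Rp_eq)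

lemma C2_Rp_phi_r: "C2_Rp (phi_r r)"
  unfolding C2_Rp_def
proof (intro conjI allI impI)
  show "phi_r r differentiable (at x within {0..})" for x
    using phi_r_has_derivative differentiable_at_withinI real_differentiable_def by blast
  show "deriv_Rp (phi_r r) differentiable (at x within {0..})" if "0 \<le> x" for x
  proof -
    \<comment> \<open>The closed form of \<open>deriv_Rp (phi_r r)\<close> is known on the half-line
      only, so differentiability is transferred within \<open>{0..}\<close>.\<close>
    let ?g = "\<lambda>x. (1 - 2 * r) * x * (1 + x\<^sup>2) powr (- (1 + 2 * r) / 2)"
    have "(?g has_derivative (*) ((1 - 2 * r) * (1 - 2 * r * x\<^sup>2)
        * (1 + x\<^sup>2) powr (- (1 + 2 * r) / 2 - 1))) (at x within {0..})"
      using has_derivative_at_withinI[OF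
          phi_r_has_second_derivative[of r x, unfolded has_field_derivative_def]] .
    then show ?thesis
      unfolding differentiable_def
      by (intro exI, rule has_derivative_transform[rotated 2])
        (use that deriv_Rp_phi_r in auto)
  qed
  have "continuous_on {0..} (\<lambda>x. (1 - 2 * r) * (1 - 2 * r * x\<^sup>2) * (1 + x\<^sup>2) powr (- (1 + 2 * r) / 2 - 1))"
    using one_plus_square_pos by (intro continuous_intros) (metis less_numeral_extra(3))
  then show "continuous_on {0..} (deriv_Rp (deriv_Rp (phi_r r)))"
    by (rule continuous_on_eq) (simp add: deriv_Rp_deriv_Rp_phi_r)
qed

lemma mono_on_phi_r: "r \<le> 1 / 2 \<Longrightarrow> mono_on {0..} (phi_r r)"
  by (auto intro!: mono_onI powr_mono2 simp: phi_r_def)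

text \<open>The sign of the second derivative is that of
  \<open>(1 - 2 * r) * (1 - 2 * r * x^2)\<close>; the threshold is the positive zero of the second
  factor, which runs off to infinity as \<open>r\<close> tends to 0.\<close>

lemma eventually_concave_phi_r:
  assumes "0 < r" "r \<le> 1 / 2"
  shows "eventually_concave (phi_r r)"
  unfolding eventually_concave_def
proof (intro exI conjI allI impI)
  let ?x0 = "sqrt (1 / (2 * r))"
  show "0 \<le> ?x0" using assms by simp
  fix x assume "?x0 \<le> x"
  then have "0 \<le> x" "1 / (2 * r) \<le> x\<^sup>2"
    using \<open>0 \<le> ?x0\<close> by (linarith, simp add: sqrt_le_D)
  then have "1 - 2 * r * x\<^sup>2 \<le> 0"
    using assms by (simp add: field_simps)
  then show "deriv_Rp (deriv_Rp (phi_r r)) x \<le> 0"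
    using assms \<open>0 \<le> x\<close>
    by (simp only: deriv_Rp_deriv_Rp_phi_r) (intro mult_nonpos_nonneg mult_nonneg_nonpos; simp)
qed

text \<open>Both \<open>1 - 2 * r\<close> and the power lie in [0,1]. The crude linear bound serves
  on bounded sets, where \<open>f\<close> may be close to 0.\<close>

lemma deriv_Rp_phi_r_bounds:
  assumes "0 \<le> r" "r \<le> 1 / 2" "0 \<le> y"
  shows "0 \<le> deriv_Rp (phi_r r) y" and "deriv_Rp (phi_r r) y \<le> y"
proof -
  let ?w = "(1 + y\<^sup>2) powr (- (1 + 2 * r) / 2)"
  show "0 \<le> deriv_Rp (phi_r r) y"
    using assms by (simp add: deriv_Rp_phi_r)
  have "?w \<le> (1 + y\<^sup>2) powr 0" using assms by (intro powr_mono) auto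
  then have "?w \<le> 1" using one_plus_square_pos[of y] by simp
  then have "((1 - 2 * r) * ?w) * y \<le> y"
    using assms by (intro mult_left_le_one_le mult_le_one) auto
  then show "deriv_Rp (phi_r r) y \<le> y"
    using assms by (simp add: deriv_Rp_phi_r mult_ac)
qed

text \<open>Replacing \<open>1 + y^2\<close> by \<open>y^2\<close> in \<phi>' leaves this expression
  times \<open>1 - 2 * r\<close>, which is the leading behaviour at infinity.\<close>

lemma powr_phi_r_exponent:
  fixes y :: real
  assumes "0 < y"
  shows "y * (y\<^sup>2) powr (- (1 + 2 * r) / 2) = y powr (- 2 * r)"
proof -
  have "2 * (- (1 + 2 * r) / 2) = - 2 * r - 1" by simp
  then have "(y\<^sup>2) powr (- (1 + 2 * r) / 2) = y powr (- 2 * r - 1)"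
    using assms powr_powr[of y 2 "- (1 + 2 * r) / 2"] by (simp only: powr_numeral)
  then show ?thesis
    using assms by (simp add: powr_diff)
qed

text \<open>Each summand is at most \<open>y powr (- 2 * r)\<close>: the first because the exponent
  is negative and \<open>y^2 \<le> 1 + y^2\<close>, the second because
  \<open>2 * r \<le> 1\<close>.\<close>

lemma weight_phi_r_le:
  assumes "0 \<le> r" "r \<le> 1 / 2" "1 \<le> y"
  shows "deriv_Rp (phi_r r) y + 1 / y \<le> 2 * y powr (- 2 * r)"
proof -
  have "(1 + y\<^sup>2) powr (- (1 + 2 * r) / 2) \<le> (y\<^sup>2) powr (- (1 + 2 * r) / 2)"
    using assms by (intro powr_mono2') auto
  then have "(1 - 2 * r) * y * (1 + y\<^sup>2) powr (- (1 + 2 * r) / 2)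
      \<le> 1 * y * (y\<^sup>2) powr (- (1 + 2 * r) / 2)"
    using assms by (intro mult_mono) auto
  also have "\<dots> = y powr (- 2 * r)"
    using assms powr_phi_r_exponent[of y r] by simp
  finally have "deriv_Rp (phi_r r) y \<le> y powr (- 2 * r)"
    using assms by (simp add: deriv_Rp_phi_r)
  moreover have "1 / y = y powr (- 1)"
    using assms by (simp add: powr_minus_divide)
  moreover have "y powr (- 1) \<le> y powr (- 2 * r)"
    using assms by (intro powr_mono) auto
  ultimately show ?thesis by simp
qed

text \<open>At \<open>r = 1 / 2\<close> the derivative of \<open>phi_r\<close> vanishes and
  \<open>1 / y\<close> is the whole bound. For smaller \<open>r\<close> the derivative alone
  suffices: \<open>1 + y^2 \<le> 2 * y^2\<close> accounts for the power of 2 in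
  \<open>k\<close>.\<close>

lemma weight_phi_r_ge:
  assumes "0 \<le> r" "r \<le> 1 / 2"
  obtains k where "0 < k"
    and "\<And>y. 1 \<le> y \<Longrightarrow> k * y powr (- 2 * r) \<le> deriv_Rp (phi_r r) y + 1 / y"
proof (cases "r = 1 / 2")
  case True
  have "1 * y powr (- 2 * r) \<le> deriv_Rp (phi_r r) y + 1 / y" if "1 \<le> y" for y
  proof -
    have "- 2 * r = - 1" using True by simp
    then show ?thesis
      using that deriv_Rp_phi_r_bounds(1)[OF assms, of y] by (simp only: powr_minus_divide) simp
  qed
  then show ?thesis using that[of 1] by simp
next
  case False
  let ?q = "- (1 + 2 * r) / 2"
  have "(1 - 2 * r) * 2 powr ?q * y powr (- 2 * r) \<le> deriv_Rp (phi_r r) y + 1 / y" if "1 \<le> y" for y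
  proof -
    have "2 powr ?q * (y\<^sup>2) powr ?q = (2 * y\<^sup>2) powr ?q"
      using that by (simp add: powr_mult)
    also have "\<dots> \<le> (1 + y\<^sup>2) powr ?q"
      using that assms one_plus_square_pos[of y] by (intro powr_mono2') auto
    finally have "(1 - 2 * r) * y * (2 powr ?q * (y\<^sup>2) powr ?q)
        \<le> (1 - 2 * r) * y * (1 + y\<^sup>2) powr ?q"
      using that assms by (intro mult_left_mono) auto
    also have "\<dots> \<le> deriv_Rp (phi_r r) y + 1 / y"
      using that by (simp add: deriv_Rp_phi_r)
    also have "(1 - 2 * r) * y * (2 powr ?q * (y\<^sup>2) powr ?q)
        = (1 - 2 * r) * 2 powr ?q * (y * (y\<^sup>2) powr ?q)" by (simp only: mult_ac)
    finally show ?thesis using powr_phi_r_exponent[of y r] that by simp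
  qed
  then show ?thesis
    using that[of "(1 - 2 * r) * 2 powr ?q"] False assms by simp
qed

section \<open>Positivity of \<open>f\<close> and nondegeneracy of its critical point\<close>

lemma standing_pos:
  fixes f :: "real ^ 'n \<Rightarrow> real"
  assumes st: "standing f \<theta>" and "x \<noteq> \<theta>"
  shows "0 < f x"
proof -
  have diff: "f differentiable (at x)" and crit: "gradient f x = 0 \<longleftrightarrow> x = \<theta>" and "f \<theta> = 0" for x
    using st by (auto simp: standing_def C2_def)
  \<comment> \<open>The cone estimate with slope 0 is Fermat's rule: a global minimizer is
    critical.\<close>
  have min_eq: "y = \<theta>" if "\<And>z. f y \<le> f z" for y
    using GDERIV_norm_le_of_lower_cone[OF GDERIV_gradient[OF diff], of 0 y] that crit by simp
  have "eventually (\<lambda>z. f \<theta> \<le> f z) at_infinity"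
    using st by (simp add: standing_def filterlim_at_top)
  then obtain R where R: "\<And>z. R \<le> norm z \<Longrightarrow> f \<theta> \<le> f z"
    by (auto simp: eventually_at_infinity)
  \<comment> \<open>The radius puts \<theta> into the ball, so the minimum there is at most
    \<open>f \<theta>\<close>, which bounds \<open>f\<close> from below outside.\<close>
  let ?K = "cball 0 (max R (norm \<theta>))"
  have "continuous_on ?K f"
    using diff by (simp add: continuous_at_imp_continuous_on differentiable_imp_continuous_within)
  then have "\<exists>y\<in>?K. \<forall>z\<in>?K. f y \<le> f z"
    by (intro continuous_attains_inf) (auto simp: le_max_iff_disj)
  then obtain y where y: "\<And>z. z \<in> ?K \<Longrightarrow> f y \<le> f z" by blast
  have "f y \<le> f z" for z
    using y[of z] y[of \<theta>] R[of z] by fastforce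
  then have nonneg: "0 \<le> f z" for z
    using min_eq[of y] \<open>f \<theta> = 0\<close> by auto
  \<comment> \<open>A second zero of \<open>f\<close> would be another global minimizer.\<close>
  show ?thesis
    using min_eq[of x] nonneg \<open>x \<noteq> \<theta>\<close> by (metis order_le_less)
qed

text \<open>An invertible Hessian is bounded below by some \<open>B\<close>; near \<theta> the
  linearization error uses up at most half of it.\<close>

lemma gradient_lower_bound_near_critical_point:
  fixes f :: "real ^ 'n \<Rightarrow> real"
  assumes "gradient f differentiable (at \<theta>)" "gradient f \<theta> = 0" "invertible (hessian f \<theta>)"
  obtains b d where "b > 0" "d > 0"
    and "\<And>x. norm (x - \<theta>) < d \<Longrightarrow> b * norm (x - \<theta>) \<le> norm (gradient f x)"
proof -
  let ?H = "\<lambda>h. hessian f \<theta> *v h"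
  obtain B where "B > 0" and B: "\<And>h. B * norm h \<le> norm (?H h)"
    using linear_inj_bounded_below_pos[OF matrix_vector_mul_linear inj_matrix_vector_mult[OF assms(3)]]
    by blast
  obtain d where "d > 0"
    and d: "\<And>x. norm (x - \<theta>) < d \<Longrightarrow> norm (gradient f x - ?H (x - \<theta>)) \<le> B / 2 * norm (x - \<theta>)"
    using has_derivative_hessian[OF assms(1)] \<open>B > 0\<close> \<open>gradient f \<theta> = 0\<close>
    unfolding has_derivative_at_alt by (metis diff_zero half_gt_zero)
  have "B / 2 * norm (x - \<theta>) \<le> norm (gradient f x)" if "norm (x - \<theta>) < d" for x
    using B[of "x - \<theta>"] d[OF that] norm_triangle_ineq2[of "?H (x - \<theta>)" "gradient f x"]
    by (simp add: norm_minus_commute)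
  then show ?thesis
    using that[of "B / 2" d] \<open>B > 0\<close> \<open>d > 0\<close> by simp
qed

section \<open>The two-sided weight bound and the growth of \<open>f\<close>\<close>

lemma powr_neg_mult_norm_power2:
  fixes y a :: real
  assumes "0 < y"
  shows "(y powr (- r) * a)\<^sup>2 = y powr (- 2 * r) * a\<^sup>2"
  using assms powr_add[of y "- r" "- r"] by (simp add: power2_eq_square mult_ac)

theorem proposition1p2:
  fixes f :: "real ^ 'n \<Rightarrow> real" and \<theta> :: "real ^ 'n" and r :: real
  assumes "standing f \<theta>"
    and "0 \<le> r" and "r \<le> 1 / 2"
    and "regular_hessian f \<theta>"
    and "Liminf at_infinity (\<lambda>x. ereal (f x powr (- r) * norm (gradient f x))) > 0"
    and "Limsup at_infinity (\<lambda>x. ereal (f x powr (- r) * norm (gradient f x))) < \<infinity>"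
  shows "(if 0 < r then H_phi f \<theta> (phi_r r) else H_phi_sans_concavity f \<theta> (phi_r r))
    \<and> Liminf at_infinity (\<lambda>x. ereal (f x * norm x powr (- (1 / (1 - r))))) > 0"
proof -
  let ?G = "gradient f"
  have C2: "C2 f" and diff: "\<And>x. f differentiable (at x)" and diffG: "\<And>x. ?G differentiable (at x)"
    and crit: "\<And>x. ?G x = 0 \<longleftrightarrow> x = \<theta>" and f0: "f \<theta> = 0"
    and lim: "filterlim f at_top at_infinity"
    using assms(1) by (auto simp: standing_def C2_def)
  note G = GDERIV_gradient[OF diff]
  have pos: "0 < f x" if "x \<noteq> \<theta>" for x
    using standing_pos[OF assms(1) that] .
  have nonneg: "0 \<le> f x" for x
    using pos[of x] f0 by (cases "x = \<theta>") auto
  have contf: "continuous_on S f" and contG: "continuous_on S ?G" for S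
    using diff diffG
    by (simp_all add: continuous_at_imp_continuous_on differentiable_imp_continuous_within)

  obtain B where "\<And>x. norm (hessian f x) \<le> B"
    using assms(4) by (auto simp: regular_hessian_def bounded_iff)
  then have B: "norm (hessian f x) \<le> \<bar>B\<bar> + 1" for x
    by (smt (verit))
  \<comment> \<open>Strictly positive, so that dividing by \<open>L\<close> is safe.\<close>
  define L where "L = \<bar>B\<bar> + 1"
  have "L > 0" by (simp add: L_def)
  have Lip: "norm (?G x - ?G y) \<le> L * norm (x - y)" for x y
    using gradient_lipschitz[OF diffG B] by (simp add: L_def)
  have Gf: "(norm (?G x))\<^sup>2 \<le> 4 * L * f x" for x
    using GDERIV_norm_le_nonneg[OF G Lip \<open>L > 0\<close> nonneg] .
  have fL: "f x \<le> L * (norm (x - \<theta>))\<^sup>2" for x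
    using GDERIV_quadratic_upper_bound[OF G Lip, of \<theta> "x - \<theta>"] crit[of \<theta>] f0 by simp

  \<comment> \<open>Real numbers beyond the lower and upper limits give one radius \<open>R\<close>
    past which the ratio lies between \<open>c\<close> and \<open>C\<close>;
    \<open>f \<ge> 1\<close> is included because the weight estimates ask for it.\<close>
  obtain c where "0 < ereal c"
    and "ereal c < Liminf at_infinity (\<lambda>x. ereal (f x powr (- r) * norm (?G x)))"
    using ereal_dense2[OF assms(5)] by blast
  then have "c > 0"
    and "eventually (\<lambda>x. ereal c < ereal (f x powr (- r) * norm (?G x))) at_infinity"
    by (simp, intro less_LiminfD)
  moreover obtain C
    where "Limsup at_infinity (\<lambda>x. ereal (f x powr (- r) * norm (?G x))) < ereal C"
    using ereal_dense2[OF assms(6)] by blast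
  then have "eventually (\<lambda>x. ereal (f x powr (- r) * norm (?G x)) < ereal C) at_infinity"
    by (rule Limsup_lessD)
  moreover have "eventually (\<lambda>x. 1 \<le> f x) at_infinity"
    using lim by (simp add: filterlim_at_top)
  ultimately have "eventually (\<lambda>x. c < f x powr (- r) * norm (?G x)
      \<and> f x powr (- r) * norm (?G x) < C \<and> 1 \<le> f x) at_infinity"
    by (simp add: eventually_conj_iff)
  then obtain R where R: "\<And>x. R \<le> norm x \<Longrightarrow> c < f x powr (- r) * norm (?G x)"
      "\<And>x. R \<le> norm x \<Longrightarrow> f x powr (- r) * norm (?G x) < C"
      "\<And>x. R \<le> norm x \<Longrightarrow> 1 \<le> f x"
    unfolding eventually_at_infinity by blast

  let ?W = "\<lambda>x. deriv_Rp (phi_r r) (f x) * (norm (?G x))\<^sup>2 + (norm (?G x))\<^sup>2 / f x"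
  have W: "?W x = (deriv_Rp (phi_r r) (f x) + 1 / f x) * (norm (?G x))\<^sup>2" for x
    by (simp add: distrib_right)
  have W_ge: "(norm (?G x))\<^sup>2 / f x \<le> ?W x" for x
    using deriv_Rp_phi_r_bounds(1)[OF assms(2,3) nonneg] by simp

  have upper: "\<exists>M>0. \<forall>x. x \<noteq> \<theta> \<longrightarrow> ?W x \<le> M"
  proof -
    have "bounded (f ` cball 0 R)"
      using contf by (intro compact_imp_bounded compact_continuous_image) auto
    then obtain F where "\<forall>x\<in>cball 0 R. norm (f x) \<le> F"
      by (auto simp: bounded_iff)
    then have F: "f x \<le> F" if "norm x \<le> R" for x
      using that by (auto dest: abs_le_D1)
    \<comment> \<open>For \<open>norm x \<le> R\<close> the two terms of the sum come from
      \<open>\<phi>'(f) \<le> f \<le> F\<close> and from \<open>Gf\<close> divided by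
      \<open>f\<close>; the other entry is the estimate at infinity.\<close>
    have "?W x \<le> max (F * (4 * L * F) + 4 * L) (2 * C\<^sup>2)" if "x \<noteq> \<theta>" for x
    proof (cases "norm x \<le> R")
      case True
      have "deriv_Rp (phi_r r) (f x) * (norm (?G x))\<^sup>2 \<le> f x * (4 * L * f x)"
        using deriv_Rp_phi_r_bounds[OF assms(2,3) nonneg] Gf nonneg by (intro mult_mono) auto
      also have "\<dots> \<le> F * (4 * L * F)"
        using F[OF True] nonneg[of x] \<open>L > 0\<close> by (intro mult_mono) auto
      finally show ?thesis
        using Gf[of x] pos[OF that] by (simp add: le_max_iff_disj add_mono divide_le_eq)
    next
      case False
      then have x: "R \<le> norm x" by simp
      have "?W x \<le> 2 * f x powr (- 2 * r) * (norm (?G x))\<^sup>2"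
        unfolding W using weight_phi_r_le[OF assms(2,3) R(3)[OF x]] by (intro mult_right_mono) auto
      also have "\<dots> = 2 * (f x powr (- r) * norm (?G x))\<^sup>2"
        using powr_neg_mult_norm_power2[OF pos[OF that]] by simp
      also have "\<dots> \<le> 2 * C\<^sup>2"
        using R(2)[OF x] by (intro mult_left_mono power_mono) auto
      finally show ?thesis by simp
    qed
    \<comment> \<open>The entry 1 makes positivity of the bound immediate.\<close>
    then have "?W x \<le> max 1 (max (F * (4 * L * F) + 4 * L) (2 * C\<^sup>2))" if "x \<noteq> \<theta>" for x
      using that by (simp add: max.coboundedI2)
    moreover have "0 < max 1 (max (F * (4 * L * F) + 4 * L) (2 * C\<^sup>2))" by simp
    ultimately show ?thesis by blast
  qed

  have lower: "\<exists>m>0. \<forall>x. x \<noteq> \<theta> \<longrightarrow> m \<le> ?W x"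
  proof -
    have "invertible (hessian f \<theta>)" using assms(4) by (simp add: regular_hessian_def)
    then obtain b d where "b > 0" "d > 0"
      and b: "\<And>x. norm (x - \<theta>) < d \<Longrightarrow> b * norm (x - \<theta>) \<le> norm (?G x)"
      using gradient_lower_bound_near_critical_point[OF diffG] crit[of \<theta>] by blast
    \<comment> \<open>The ratio of the linear lower bound on the gradient, squared, to the quadratic
      upper bound \<open>fL\<close>.\<close>
    have near: "b\<^sup>2 / L \<le> ?W x" if "x \<noteq> \<theta>" "norm (x - \<theta>) < d" for x
    proof -
      have "b\<^sup>2 * f x \<le> b\<^sup>2 * (L * (norm (x - \<theta>))\<^sup>2)"
        using fL by (intro mult_left_mono) auto
      also have "\<dots> = L * (b * norm (x - \<theta>))\<^sup>2" by (simp add: power_mult_distrib)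
      also have "\<dots> \<le> L * (norm (?G x))\<^sup>2"
        using b[OF that(2)] \<open>b > 0\<close> \<open>L > 0\<close> by (intro mult_left_mono power_mono) auto
      finally have "b\<^sup>2 / L \<le> (norm (?G x))\<^sup>2 / f x"
        using pos[OF that(1)] \<open>L > 0\<close> by (simp add: field_simps)
      then show ?thesis using W_ge[of x] by linarith
    qed
    \<comment> \<open>On this compact set without \<theta> the quotient is continuous and positive,
      so it attains a positive minimum unless the set is empty.\<close>
    let ?K = "cball 0 R - ball \<theta> d" and ?q = "\<lambda>x. (norm (?G x))\<^sup>2 / f x"
    have "\<exists>q>0. \<forall>x\<in>?K. q \<le> ?q x"
    proof (cases "?K = {}")
      case False
      have \<theta>: "x \<noteq> \<theta>" if "x \<in> ?K" for x using that \<open>d > 0\<close> by auto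
      have "continuous_on ?K ?q"
        using pos \<theta> by (intro continuous_intros contf contG) (metis less_irrefl)
      then have "\<exists>y\<in>?K. \<forall>z\<in>?K. ?q y \<le> ?q z"
        using False by (intro continuous_attains_inf compact_diff) auto
      then obtain y where "y \<in> ?K" "\<And>z. z \<in> ?K \<Longrightarrow> ?q y \<le> ?q z" by blast
      moreover from this have "0 < ?q y"
        using pos[OF \<theta>] crit[of y] \<theta>[of y] by simp
      ultimately show ?thesis by blast
    qed (auto intro: zero_less_one)
    then obtain q where "q > 0" and q: "\<And>x. x \<in> ?K \<Longrightarrow> q \<le> ?q x" by blast
    obtain k where "k > 0"
      and k: "\<And>y. 1 \<le> y \<Longrightarrow> k * y powr (- 2 * r) \<le> deriv_Rp (phi_r r) y + 1 / y"
      using weight_phi_r_ge[OF assms(2,3)] by blast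
    have far: "k * c\<^sup>2 \<le> ?W x" if "x \<noteq> \<theta>" and x: "R \<le> norm x" for x
    proof -
      have "k * c\<^sup>2 \<le> k * (f x powr (- r) * norm (?G x))\<^sup>2"
        using R(1)[OF x] \<open>c > 0\<close> \<open>k > 0\<close> by (intro mult_left_mono power_mono) auto
      also have "\<dots> = k * f x powr (- 2 * r) * (norm (?G x))\<^sup>2"
        using powr_neg_mult_norm_power2[OF pos[OF that(1)]] by simp
      also have "\<dots> \<le> ?W x"
        unfolding W using k[OF R(3)[OF x]] by (intro mult_right_mono) auto
      finally show ?thesis .
    qed
    define m where "m = min (b\<^sup>2 / L) (min q (k * c\<^sup>2))"
    have "m > 0"
      using \<open>b > 0\<close> \<open>L > 0\<close> \<open>q > 0\<close> \<open>k > 0\<close> \<open>c > 0\<close> by (simp add: m_def)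
    moreover have "m \<le> ?W x" if x: "x \<noteq> \<theta>" for x
    proof -
      consider "norm (x - \<theta>) < d" | "R \<le> norm x" | "x \<in> ?K"
        by (force simp: dist_norm norm_minus_commute)
      then show ?thesis
      proof cases
        case 1 then show ?thesis using near[OF x] by (simp add: m_def)
      next
        case 2 then show ?thesis using far[OF x] by (simp add: m_def)
      next
        case 3 then have "q \<le> ?W x" using q[of x] W_ge[of x] by linarith
        then show ?thesis by (simp add: m_def)
      qed
    qed
    ultimately show ?thesis by blast
  qed

  have "\<exists>m>0. \<exists>M>0. \<forall>x. x \<noteq> \<theta> \<longrightarrow> m \<le> ?W x \<and> ?W x \<le> M"
    using upper lower by blast
  moreover have "0 \<le> phi_r r x" for x
    by (simp add: phi_r_def)
  ultimately have "H_phi_sans_concavity f \<theta> (phi_r r)"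
    unfolding H_phi_sans_concavity_def
    using C2 assms(4) C2_Rp_phi_r mono_on_phi_r[OF assms(3)] by blast
  moreover have "eventually_concave (phi_r r)" if "0 < r"
    using eventually_concave_phi_r[OF that assms(3)] .
  moreover have "0 < Liminf at_infinity (\<lambda>x. ereal (f x * norm x powr (- (1 / (1 - r)))))"
  proof -
    have r: "1 - r > 0" using assms(3) by simp
    \<comment> \<open>The gradient of \<open>f powr (1 - r)\<close> is
      \<open>(1 - r) * f powr (- r)\<close> times that of \<open>f\<close>, hence of norm above
      \<open>k\<close> once \<open>norm x \<ge> R\<close>.\<close>
    define k where "k = (1 - r) * c"
    have "k > 0" using r \<open>c > 0\<close> by (simp add: k_def)
    have growth: "k * (norm x - R) \<le> f x powr (1 - r)" for x
    proof (rule linear_growth_of_gradient_bound)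
      \<comment> \<open>Continuity at \<theta>, where \<open>f\<close> vanishes, rests on the
        exponent being positive.\<close>
      show "continuous_on UNIV (\<lambda>x. f x powr (1 - r))"
        using nonneg r by (intro continuous_on_powr' contf continuous_on_const) auto
      fix y :: "real ^ 'n" assume y: "R \<le> norm y"
      have "0 < f y" using R(3)[OF y] by simp
      then have "((\<lambda>z. z powr (1 - r)) has_real_derivative (1 - r) * f y powr (- r)) (at (f y))"
        by (auto intro!: derivative_eq_intros)
      then have "GDERIV (\<lambda>x. f x powr (1 - r)) y :> ((1 - r) * f y powr (- r)) *\<^sub>R ?G y"
        by (rule GDERIV_DERIV_compose[OF G])
      moreover have "k < norm (((1 - r) * f y powr (- r)) *\<^sub>R ?G y)"
        using R(1)[OF y] r by (simp add: k_def abs_mult mult.assoc)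
      ultimately show "\<exists>D. GDERIV (\<lambda>x. f x powr (1 - r)) y :> D \<and> k < norm D" by blast
    qed (use \<open>k > 0\<close> in auto)
    let ?s = "1 / (1 - r)"
    \<comment> \<open>Beyond \<open>2 * R\<close> the difference \<open>norm x - R\<close> is at
      least half of \<open>norm x\<close>; the bound 1 keeps \<open>norm x\<close> nonzero so that
      the opposite powers cancel.\<close>
    have "(k / 2) powr ?s \<le> f x * norm x powr (- ?s)" if x: "max 1 (2 * R) \<le> norm x" for x
    proof -
      have "k / 2 * norm x \<le> k * (norm x - R)"
        using x \<open>k > 0\<close> by (simp add: field_simps)
      also note growth
      finally have "(k / 2 * norm x) powr ?s \<le> (f x powr (1 - r)) powr ?s"
        using r \<open>k > 0\<close> by (intro powr_mono2) auto
      also have "\<dots> = f x" using r nonneg[of x] by (simp add: powr_powr)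
      also have "(k / 2 * norm x) powr ?s = (k / 2) powr ?s * norm x powr ?s"
        by (rule powr_mult)
      finally have "(k / 2) powr ?s * norm x powr ?s * norm x powr (- ?s) \<le> f x * norm x powr (- ?s)"
        by (rule mult_right_mono) simp
      moreover have "norm x powr ?s * norm x powr (- ?s) = 1"
        using x by (subst powr_add[symmetric]) auto
      ultimately show ?thesis by (simp add: mult.assoc)
    qed
    then have "eventually (\<lambda>x. ereal ((k / 2) powr ?s) \<le> ereal (f x * norm x powr (- ?s))) at_infinity"
      unfolding eventually_at_infinity ereal_less_eq by blast
    then have "ereal ((k / 2) powr ?s) \<le> Liminf at_infinity (\<lambda>x. ereal (f x * norm x powr (- ?s)))"
      by (rule Liminf_bounded)
    moreover have "0 < ereal ((k / 2) powr ?s)" using \<open>k > 0\<close> by simp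
    ultimately show ?thesis by (rule less_le_trans[rotated])
  qed
  ultimately show ?thesis
    by (simp add: H_phi_def)
qed

end
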